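(* There exists a one-sided error tester for additivity of measurable functions $f\colon\mathbb{R}^n\to\mathbb{R}$ over the standard Gaussian $\mathcal{N}(0,I)$ that makes $O\left(\frac{1}{\varepsilon}\log\frac{1}{\varepsilon}\right)$ queries.
   Context: $f$ is additive if $f(x+y)=f(x)+f(y)$ for all $x,y\in\mathbb{R}^n$. A measurable $f$ is $\varepsilon$-far from additivity if $\Pr_{x\sim\mathcal{N}(0,I)}[f(x)\neq g(x)]>\varepsilon$ for every measurable additive $g$. A tester is given query access to $f$, sampling access to $\mathcal{N}(0,I)$, and $\varepsilon>0$; it must accept with probability at least $2/3$ if $f$ is additive and reject with probability at least $2/3$ if $f$ is $\varepsilon$-far from additive. One-sided error means additive functions are accepted with probability $1$. *)

theory Defs
  imports "HOL-Probability.Probability" "HOL-Library.Landau_Symbols"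
begin

text \<open>
  The query bound has to be uniform in the dimension, so \<open>n\<close> must be quantified inside the
  statement. The space \<open>\<real>\<^sup>n\<close> is therefore the carrier of a finite product measure space: its
  points are the functions on \<open>{..<n}\<close>, extended by \<^const>\<open>undefined\<close>. Functions on \<open>\<real>\<^sup>n\<close>
  are only ever evaluated on this carrier.
\<close>

type_synonym vec = "nat \<Rightarrow> real"

definition borel_Rn :: "nat \<Rightarrow> vec measure" where
  "borel_Rn n = (\<Pi>\<^sub>M i\<in>{..<n}. borel)"

abbreviation Rn :: "nat \<Rightarrow> vec set" where
  "Rn n \<equiv> space (borel_Rn n)"

definition vadd :: "nat \<Rightarrow> vec \<Rightarrow> vec \<Rightarrow> vec" where
  "vadd n x y = (\<lambda>i\<in>{..<n}. x i + y i)"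

definition std_gaussian :: "nat \<Rightarrow> vec measure" where
  "std_gaussian n = (\<Pi>\<^sub>M i\<in>{..<n}. density lborel std_normal_density)"

definition additive_fun :: "nat \<Rightarrow> (vec \<Rightarrow> real) \<Rightarrow> bool" where
  "additive_fun n f \<longleftrightarrow> (\<forall>x\<in>Rn n. \<forall>y\<in>Rn n. f (vadd n x y) = f x + f y)"

definition far_from_additive :: "nat \<Rightarrow> real \<Rightarrow> (vec \<Rightarrow> real) \<Rightarrow> bool" where
  "far_from_additive n \<epsilon> f \<longleftrightarrow>
     (\<forall>g \<in> borel_measurable (borel_Rn n). additive_fun n g \<longrightarrow>
        measure (std_gaussian n) {x \<in> Rn n. f x \<noteq> g x} > \<epsilon>)"

text \<open>
  An adaptive algorithm is a well-founded, possibly infinitely branching decision tree. It halts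
  with a verdict, or queries the oracle at a point and continues depending on the answer, or draws
  a fresh sample and continues depending on the sample. The samples are its only randomness.
\<close>

datatype algorithm =
    Accept
  | Reject
  | Query vec "real \<Rightarrow> algorithm"
  | Sample "vec \<Rightarrow> algorithm"

primrec well_formed :: "nat \<Rightarrow> algorithm \<Rightarrow> bool" where
  "well_formed n Accept = True"
| "well_formed n Reject = True"
| "well_formed n (Query x k) = (x \<in> Rn n \<and> (\<forall>r. well_formed n (k r)))"
| "well_formed n (Sample k) = (\<forall>x\<in>Rn n. well_formed n (k x))"

text \<open>
  The run on the oracle \<open>f\<close>, where \<open>\<omega>\<close> is the sequence of samples handed out on demand.
\<close>

primrec accepts :: "algorithm \<Rightarrow> (vec \<Rightarrow> real) \<Rightarrow> vec stream \<Rightarrow> bool" where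
  "accepts Accept f \<omega> = True"
| "accepts Reject f \<omega> = False"
| "accepts (Query x k) f \<omega> = accepts (k (f x)) f \<omega>"
| "accepts (Sample k) f \<omega> = accepts (k (shd \<omega>)) f (stl \<omega>)"

primrec num_queries :: "algorithm \<Rightarrow> (vec \<Rightarrow> real) \<Rightarrow> vec stream \<Rightarrow> nat" where
  "num_queries Accept f \<omega> = 0"
| "num_queries Reject f \<omega> = 0"
| "num_queries (Query x k) f \<omega> = Suc (num_queries (k (f x)) f \<omega>)"
| "num_queries (Sample k) f \<omega> = num_queries (k (shd \<omega>)) f (stl \<omega>)"

definition samples :: "nat \<Rightarrow> vec stream measure" where
  "samples n = stream_space (std_gaussian n)"

definition accept_event :: "nat \<Rightarrow> algorithm \<Rightarrow> (vec \<Rightarrow> real) \<Rightarrow> vec stream set" where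
  "accept_event n T f = {\<omega> \<in> space (samples n). accepts T f \<omega>}"

definition reject_event :: "nat \<Rightarrow> algorithm \<Rightarrow> (vec \<Rightarrow> real) \<Rightarrow> vec stream set" where
  "reject_event n T f = {\<omega> \<in> space (samples n). \<not> accepts T f \<omega>}"

definition additivity_tester :: "nat \<Rightarrow> real \<Rightarrow> algorithm \<Rightarrow> bool" where
  "additivity_tester n \<epsilon> T \<longleftrightarrow>
     well_formed n T \<and>
     (\<forall>f \<in> borel_measurable (borel_Rn n).
        accept_event n T f \<in> sets (samples n) \<and>
        (additive_fun n f \<longrightarrow> measure (samples n) (accept_event n T f) \<ge> 2/3) \<and>
        (far_from_additive n \<epsilon> f \<longrightarrow> measure (samples n) (reject_event n T f) \<ge> 2/3))"

definition one_sided :: "nat \<Rightarrow> algorithm \<Rightarrow> bool" where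
  "one_sided n T \<longleftrightarrow>
     (\<forall>f \<in> borel_measurable (borel_Rn n). additive_fun n f \<longrightarrow>
        measure (samples n) (accept_event n T f) = 1)"

definition makes_at_most :: "nat \<Rightarrow> algorithm \<Rightarrow> nat \<Rightarrow> bool" where
  "makes_at_most n T q \<longleftrightarrow>
     (\<forall>f \<in> borel_measurable (borel_Rn n). \<forall>\<omega> \<in> space (samples n). num_queries T f \<omega> \<le> q)"

end

theory Submission imports Defs begin

text \<open>
  One round draws Gaussian \<open>x\<close>, \<open>y\<close> and checks \<open>f (x + y) = f x + f y\<close> and
  \<open>f x = 2\<^sup>k (f (x / 2\<^sup>k + y) - f y)\<close>, where \<open>k\<close> depends on \<open>n\<close> and \<open>\<epsilon>\<close> but costs no
  queries. A Gaussian is almost invariant under small shifts \<open>p\<close>, so if the first check passes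
  with probability at least \<open>31/32\<close>, then \<open>f (p + y)\<close> and \<open>f (p + z)\<close> can be compared through
  \<open>f (p + y + z)\<close>: the increment \<open>f (p + y) - f y\<close> takes one value \<open>g p\<close> with probability at
  least \<open>7/8\<close>. This \<open>g\<close> is additive near the origin and extends to an additive measurable function
  by \<open>x \<mapsto> 2\<^sup>k g (x / 2\<^sup>k)\<close>. Wherever \<open>f\<close> differs from the extension, the second check fails with
  probability at least \<open>7/8\<close> over \<open>y\<close>. Hence a round rejects an \<open>\<epsilon>\<close>-far function with probability
  at least \<open>\<epsilon>/32\<close>, and \<open>O(1/\<epsilon>)\<close> rounds suffice.
\<close>

text \<open>Fubini for a single event, with real-valued probabilities, so that bounds over pairs can
  be obtained section by section.\<close>

lemma prob_pair_measure:
  assumes "prob_space M" "prob_space N" and C: "C \<in> sets (M \<Otimes>\<^sub>M N)"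
  shows "integrable M (\<lambda>x. measure N (Pair x -` C))"
    and "measure (M \<Otimes>\<^sub>M N) C = (\<integral>x. measure N (Pair x -` C) \<partial>M)"
proof -
  interpret M: prob_space M by fact
  interpret N: prob_space N by fact
  interpret P: pair_prob_space M N ..
  have [measurable]: "(\<lambda>x. measure N (Pair x -` C)) \<in> borel_measurable M"
    using N.measurable_emeasure_Pair[OF C] by (simp add: measure_def)
  show *: "integrable M (\<lambda>x. measure N (Pair x -` C))"
    by (rule M.integrable_const_bound[where B=1]) auto
  have "emeasure (M \<Otimes>\<^sub>M N) C = (\<integral>\<^sup>+x. ennreal (measure N (Pair x -` C)) \<partial>M)"
    by (simp add: N.emeasure_pair_measure_alt[OF C] N.emeasure_eq_measure)
  also have "\<dots> = ennreal (\<integral>x. measure N (Pair x -` C) \<partial>M)"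
    by (rule nn_integral_eq_integral[OF *]) auto
  finally show "measure (M \<Otimes>\<^sub>M N) C = (\<integral>x. measure N (Pair x -` C) \<partial>M)"
    by (simp add: measure_def)
qed

section \<open>Almost invariant measures\<close>

text \<open>On a probability space, passing to complements yields the reverse inequality, so this
  bounds the total variation distance between \<open>M\<close> and its image under \<open>S\<close>
  by \<open>a\<close>.\<close>

definition almost_invariant :: "'a measure \<Rightarrow> ('a \<Rightarrow> 'a) \<Rightarrow> real \<Rightarrow> bool" where
  "almost_invariant M S a \<longleftrightarrow> S \<in> M \<rightarrow>\<^sub>M M \<and>
     (\<forall>A\<in>sets M. measure M A - a \<le> measure M (S -` A \<inter> space M))"

lemma almost_invariantD:
  assumes "almost_invariant M S a" "A \<in> sets M"
  shows "S -` A \<inter> space M \<in> sets M" "measure M A - a \<le> measure M (S -` A \<inter> space M)"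
  using assms by (auto simp: almost_invariant_def dest: measurable_sets)

lemma almost_invariant_mono:
  "almost_invariant M S a \<Longrightarrow> a \<le> b \<Longrightarrow> almost_invariant M S b"
  unfolding almost_invariant_def by force

lemma almost_invariant_comp:
  assumes "almost_invariant M S a" "almost_invariant M T b"
  shows "almost_invariant M (\<lambda>x. S (T x)) (a + b)"
proof -
  have [measurable]: "S \<in> M \<rightarrow>\<^sub>M M" "T \<in> M \<rightarrow>\<^sub>M M" using assms by (auto simp: almost_invariant_def)
  have "measure M A - (a + b) \<le> measure M ((\<lambda>x. S (T x)) -` A \<inter> space M)" if A: "A \<in> sets M" for A
  proof -
    have *: "S -` A \<inter> space M \<in> sets M" using A by measurable
    have "(\<lambda>x. S (T x)) -` A \<inter> space M = T -` (S -` A \<inter> space M) \<inter> space M"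
      using measurable_space[of T M M] by auto
    then have "measure M (S -` A \<inter> space M) - b \<le> measure M ((\<lambda>x. S (T x)) -` A \<inter> space M)"
      using assms(2) * by (auto simp: almost_invariant_def)
    moreover have "measure M A - a \<le> measure M (S -` A \<inter> space M)"
      using assms(1) A by (auto simp: almost_invariant_def)
    ultimately show ?thesis by simp
  qed
  then show ?thesis by (auto simp: almost_invariant_def)
qed

text \<open>Every section of the preimage is the preimage under \<open>T\<close> of a section, so
  the bound for \<open>N\<close> integrates over the first coordinate.\<close>

lemma almost_invariant_snd:
  assumes M: "prob_space M" and N: "prob_space N" and T: "almost_invariant N T b"
  shows "almost_invariant (M \<Otimes>\<^sub>M N) (\<lambda>(x, y). (x, T y)) b"
proof -
  interpret M: prob_space M by fact
  interpret N: prob_space N by fact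
  have [measurable]: "T \<in> N \<rightarrow>\<^sub>M N" using T by (auto simp: almost_invariant_def)
  have "measure (M \<Otimes>\<^sub>M N) C - b \<le> measure (M \<Otimes>\<^sub>M N) ((\<lambda>(x, y). (x, T y)) -` C \<inter> space (M \<Otimes>\<^sub>M N))"
    if C[measurable]: "C \<in> sets (M \<Otimes>\<^sub>M N)" for C
  proof -
    let ?C = "(\<lambda>(x, y). (x, T y)) -` C \<inter> space (M \<Otimes>\<^sub>M N)"
    have C': "?C \<in> sets (M \<Otimes>\<^sub>M N)" by measurable
    note c = prob_pair_measure[OF M N C] and c' = prob_pair_measure[OF M N C']
    have "(\<integral>x. measure N (Pair x -` C) - b \<partial>M) \<le> (\<integral>x. measure N (Pair x -` ?C) \<partial>M)"
    proof (rule integral_mono)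
      fix x assume "x \<in> space M"
      then have "Pair x -` ?C = T -` (Pair x -` C) \<inter> space N"
        by (auto simp: space_pair_measure)
      moreover have "Pair x -` C \<in> sets N" by (rule sets_Pair1[OF C])
      ultimately show "measure N (Pair x -` C) - b \<le> measure N (Pair x -` ?C)"
        using T by (auto simp: almost_invariant_def)
    qed (use c c' in auto)
    then show ?thesis using c c' by (simp add: M.prob_space)
  qed
  then show ?thesis by (auto simp: almost_invariant_def)
qed

text \<open>Transfer along a factor map: \<open>h\<close> carries \<open>N\<close> to
  \<open>M\<close> and intertwines \<open>T\<close> with \<open>S\<close>, so both preimages can be
  measured in \<open>N\<close>. It serves for swapping coordinates and for splitting one coordinate
  off a finite product.\<close>

lemma almost_invariant_distr:
  assumes T: "almost_invariant N T a" and h: "h \<in> N \<rightarrow>\<^sub>M M" "distr N M h = M"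
    and S: "S \<in> M \<rightarrow>\<^sub>M M" and eq: "\<And>x. x \<in> space N \<Longrightarrow> h (T x) = S (h x)"
  shows "almost_invariant M S a"
  unfolding almost_invariant_def
proof (intro conjI ballI S)
  fix A assume A: "A \<in> sets M"
  have T': "T \<in> N \<rightarrow>\<^sub>M N" using T by (auto simp: almost_invariant_def)
  have *: "measure M B = measure N (h -` B \<inter> space N)" if "B \<in> sets M" for B
    using measure_distr[OF h(1) that] h(2) by simp
  have "measure M A - a \<le> measure N (T -` (h -` A \<inter> space N) \<inter> space N)"
    using T *[OF A] measurable_sets[OF h(1) A] by (auto simp: almost_invariant_def)
  also have "T -` (h -` A \<inter> space N) \<inter> space N = h -` (S -` A \<inter> space M) \<inter> space N"
    using measurable_space[OF h(1)] measurable_space[OF T'] eq by auto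
  also have "measure N \<dots> = measure M (S -` A \<inter> space M)"
    using *[OF measurable_sets[OF S A]] by simp
  finally show "measure M A - a \<le> measure M (S -` A \<inter> space M)" .
qed

lemma almost_invariant_fst:
  assumes M: "prob_space M" and N: "prob_space N" and S: "almost_invariant M S a"
  shows "almost_invariant (M \<Otimes>\<^sub>M N) (\<lambda>(x, y). (S x, y)) a"
proof (rule almost_invariant_distr[OF almost_invariant_snd[OF N M S]])
  interpret M: prob_space M by fact
  interpret N: prob_space N by fact
  interpret P: pair_prob_space M N ..
  have [measurable]: "S \<in> M \<rightarrow>\<^sub>M M" using S by (auto simp: almost_invariant_def)
  show "distr (N \<Otimes>\<^sub>M M) (M \<Otimes>\<^sub>M N) (\<lambda>(x, y). (y, x)) = M \<Otimes>\<^sub>M N"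
    using P.distr_pair_swap by simp
  show "(\<lambda>(x, y). (S x, y)) \<in> M \<Otimes>\<^sub>M N \<rightarrow>\<^sub>M M \<Otimes>\<^sub>M N" by measurable
qed (auto simp: measurable_pair_swap')

text \<open>Coordinates are moved one after another; by \<open>almost_invariant_comp\<close> the
  errors add.\<close>

lemma almost_invariant_PiM:
  assumes "finite I" and M: "\<And>i. i \<in> I \<Longrightarrow> prob_space (M i)"
    and S: "\<And>i. i \<in> I \<Longrightarrow> almost_invariant (M i) (S i) (a i)"
  shows "almost_invariant (PiM I M) (\<lambda>x. \<lambda>i\<in>I. S i (x i)) (\<Sum>i\<in>I. a i)"
  using assms
proof (induction I)
  case empty
  show ?case
    unfolding almost_invariant_def
  proof (intro conjI ballI)
    fix A assume "A \<in> sets (PiM {} M)"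
    have "(\<lambda>x. \<lambda>i\<in>{}. S i (x i)) -` A \<inter> space (PiM {} M) = A \<inter> space (PiM {} M)"
      by (auto simp: space_PiM restrict_def)
    then show "measure (PiM {} M) A - (\<Sum>i\<in>{}. a i) \<le> measure (PiM {} M) ((\<lambda>x. \<lambda>i\<in>{}. S i (x i)) -` A \<inter> space (PiM {} M))"
      using sets.sets_into_space[OF \<open>A \<in> sets (PiM {} M)\<close>] by (simp add: Int_absorb2)
  qed (intro measurable_restrict, simp)
next
  case (insert j I)
  let ?P = "M j \<Otimes>\<^sub>M PiM I M" and ?SI = "\<lambda>x. \<lambda>i\<in>I. S i (x i)"
  have P: "prob_space (M j)" "prob_space (PiM I M)"
    using insert.prems by (auto intro!: prob_space_PiM)
  have "almost_invariant ?P (\<lambda>z. (\<lambda>(x, y). (S j x, y)) ((\<lambda>(x, y). (x, ?SI y)) z)) (a j + (\<Sum>i\<in>I. a i))"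
    by (intro almost_invariant_comp[OF almost_invariant_fst[OF P] almost_invariant_snd[OF P]] insert.IH insert.prems) auto
  then show ?case
    unfolding sum.insert[OF insert.hyps]
  proof (rule almost_invariant_distr)
    show "distr ?P (PiM (insert j I) M) (\<lambda>(x, X). X(j := x)) = PiM (insert j I) M"
      using distr_pair_PiM_eq_PiM[of I M j] insert.prems by auto
    show "(\<lambda>(x, X). X(j := x)) \<in> ?P \<rightarrow>\<^sub>M PiM (insert j I) M" by measurable
    have "S i \<in> M i \<rightarrow>\<^sub>M M i" if "i \<in> insert j I" for i
      using insert.prems(2)[OF that] by (auto simp: almost_invariant_def)
    then show "(\<lambda>x. \<lambda>i\<in>insert j I. S i (x i)) \<in> PiM (insert j I) M \<rightarrow>\<^sub>M PiM (insert j I) M"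
      by (intro measurable_restrict) (auto intro!: measurable_compose[OF measurable_component_singleton])
    show "(\<lambda>(x, X). X(j := x)) ((\<lambda>(x, y). (S j x, y)) ((\<lambda>(x, y). (x, ?SI y)) z))
        = (\<lambda>i\<in>insert j I. S i (((\<lambda>(x, X). X(j := x)) z) i))" if "z \<in> space ?P" for z
      using insert.hyps by (auto simp: split_beta fun_eq_iff)
  qed
qed

text \<open>Shifting by \<open>t\<close> multiplies the density by \<open>exp (t x - t\<^sup>2/2) \<ge> 1 + t x - t\<^sup>2/2\<close>.\<close>

lemma normal_shift_almost_invariant:
  "\<exists>C\<ge>0. \<forall>t. almost_invariant (density lborel std_normal_density) (\<lambda>x. t + x) (C * \<bar>t\<bar> + t\<^sup>2 / 2)"
proof -
  \<comment> \<open>The first absolute moment of the Gaussian; it bounds the loss from the linear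
    term \<open>t * x\<close>.\<close>
  define C where "C = (\<integral>x. std_normal_density x * \<bar>x\<bar> \<partial>lborel)"
  let ?N = "density lborel std_normal_density"
  interpret N: prob_space ?N by (rule prob_space_normal_density) simp
  have int0: "integrable lborel (\<lambda>x. std_normal_density x)" 
    using integrable_normal_density[of 1 0] by simp
  have int1: "integrable lborel (\<lambda>x. std_normal_density x * \<bar>x\<bar>)"
    using integrable_std_normal_moment_abs[of 1] by simp
  have meas: "measure ?N A = (\<integral>x. std_normal_density x * indicator A x \<partial>lborel)" 
    "integrable lborel (\<lambda>x. std_normal_density x * indicator A x)" if [measurable]: "A \<in> sets borel" for A
  proof -
    show i: "integrable lborel (\<lambda>x. std_normal_density x * indicator A x)"
      using integrable_real_mult_indicator[OF _ int0, of A] by simp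
    have "emeasure ?N A = (\<integral>\<^sup>+x. ennreal (std_normal_density x * indicator A x) \<partial>lborel)"
      by (subst emeasure_density) (auto intro!: nn_integral_cong simp: indicator_def)
    also have "\<dots> = ennreal (\<integral>x. std_normal_density x * indicator A x \<partial>lborel)"
      by (rule nn_integral_eq_integral[OF i]) auto
    finally show "measure ?N A = (\<integral>x. std_normal_density x * indicator A x \<partial>lborel)"
      by (simp add: measure_def integral_nonneg_AE)
  qed
  have "measure ?N A - (C * \<bar>t\<bar> + t\<^sup>2 / 2) \<le> measure ?N ((+) t -` A)"
    if [measurable]: "A \<in> sets borel" for A t
  proof -
    let ?\<phi> = std_normal_density
    have [measurable]: "(+) t -` A \<in> sets borel"
      using measurable_sets[of "(+) t" borel borel A] by simp
    have ind: "indicator ((+) t -` A) x = (indicator A (t + x) :: real)" for x by (auto simp: indicator_def)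
    have i2: "integrable lborel (\<lambda>x. ?\<phi> (x - t) * indicator A x)"
      using lborel_integrable_real_affine_iff[of 1 "\<lambda>x. ?\<phi> (x - t) * indicator A x" t] meas(2)[of "(+) t -` A"]
      by (simp add: ind)
    have "measure ?N ((+) t -` A) = (\<integral>x. ?\<phi> x * indicator A (t + x) \<partial>lborel)"
      by (simp add: meas ind)
    \<comment> \<open>The substitution moves the shift from the set to the density, where it can be
      compared pointwise.\<close>
    also have "\<dots> = (\<integral>x. ?\<phi> (x - t) * indicator A x \<partial>lborel)"
      using lborel_integral_real_affine[of 1 "\<lambda>x. ?\<phi> (x - t) * indicator A x" t] by simp
    also have "\<dots> \<ge> (\<integral>x. ?\<phi> x * indicator A x - (?\<phi> x * \<bar>x\<bar> * \<bar>t\<bar> + ?\<phi> x * (t\<^sup>2 / 2)) \<partial>lborel)"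
    proof (rule integral_mono)
      fix x
      have "?\<phi> (x - t) = ?\<phi> x * exp (t * x - t\<^sup>2 / 2)"
        by (simp add: std_normal_density_def mult_exp_exp power2_eq_square field_simps)
      also have "\<dots> \<ge> ?\<phi> x * (1 + (t * x - t\<^sup>2 / 2))"
        by (intro mult_left_mono exp_ge_add_one_self) auto
      finally have 1: "?\<phi> (x - t) \<ge> ?\<phi> x * (1 + (t * x - t\<^sup>2 / 2))" .
      have "- (\<bar>x\<bar> * \<bar>t\<bar>) \<le> t * x" by (metis abs_ge_minus_self abs_mult minus_le_iff mult.commute)
      then have 2: "?\<phi> x * (1 + (t * x - t\<^sup>2 / 2)) \<ge> ?\<phi> x * (1 - \<bar>x\<bar> * \<bar>t\<bar> - t\<^sup>2 / 2)"
        by (intro mult_left_mono) auto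
      have 3: "0 \<le> ?\<phi> x * \<bar>x\<bar> * \<bar>t\<bar> + ?\<phi> x * (t\<^sup>2 / 2)" by simp
      have 4: "?\<phi> x * (1 - \<bar>x\<bar> * \<bar>t\<bar> - t\<^sup>2 / 2) = ?\<phi> x - (?\<phi> x * \<bar>x\<bar> * \<bar>t\<bar> + ?\<phi> x * (t\<^sup>2 / 2))"
        by (simp add: algebra_simps)
      show "?\<phi> x * indicator A x - (?\<phi> x * \<bar>x\<bar> * \<bar>t\<bar> + ?\<phi> x * (t\<^sup>2 / 2)) \<le> ?\<phi> (x - t) * indicator A x"
      proof (cases "x \<in> A")
        case True
        then show ?thesis using 1 2 4 by simp
      next
        case False
        then have "indicator A x = (0::real)" by simp
        then show ?thesis using 3 by (simp only:)
      qed
    qed (use int0 int1 meas(2)[of A] i2 in auto)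
    also have "(\<integral>x. ?\<phi> x * indicator A x - (?\<phi> x * \<bar>x\<bar> * \<bar>t\<bar> + ?\<phi> x * (t\<^sup>2 / 2)) \<partial>lborel)
        = measure ?N A - (C * \<bar>t\<bar> + t\<^sup>2 / 2)"
      using int0 int1 meas[of A] by (simp add: C_def)
    finally show ?thesis by simp
  qed
  then have "\<forall>t. almost_invariant ?N (\<lambda>x. t + x) (C * \<bar>t\<bar> + t\<^sup>2 / 2)"
    by (auto simp: almost_invariant_def)
  moreover have "C \<ge> 0" by (auto simp: C_def intro!: integral_nonneg_AE)
  ultimately show ?thesis by blast
qed

section \<open>Small Gaussian shifts\<close>

definition vscale :: "nat \<Rightarrow> real \<Rightarrow> vec \<Rightarrow> vec" where
  "vscale n c x = (\<lambda>i\<in>{..<n}. c * x i)"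

text \<open>A ball in the sup norm, because the shift estimate is made coordinate by
  coordinate.\<close>

definition cube :: "nat \<Rightarrow> real \<Rightarrow> vec set" where
  "cube n r = {x \<in> Rn n. \<forall>i<n. \<bar>x i\<bar> \<le> r}"

lemma Rn_eq: "Rn n = (\<Pi>\<^sub>E i\<in>{..<n}. UNIV)"
  by (simp add: borel_Rn_def space_PiM)

lemma vadd_in_Rn [simp]: "vadd n x y \<in> Rn n"
  by (auto simp: Rn_eq vadd_def)

lemma vscale_in_Rn [simp]: "vscale n c x \<in> Rn n"
  by (auto simp: Rn_eq vscale_def)

lemma vscale_apply: "i < n \<Longrightarrow> vscale n c x i = c * x i"
  by (simp add: vscale_def)

lemma vadd_assoc: "vadd n (vadd n x y) z = vadd n x (vadd n y z)"
  by (auto simp: vadd_def fun_eq_iff)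

lemma vadd_left_commute: "vadd n x (vadd n y z) = vadd n y (vadd n x z)"
  by (auto simp: vadd_def fun_eq_iff)

lemma vscale_vadd: "vscale n c (vadd n x y) = vadd n (vscale n c x) (vscale n c y)"
  by (auto simp: vscale_def vadd_def fun_eq_iff algebra_simps)

lemma vadd_vscale_half:
  "vadd n (vscale n (1 / 2 ^ Suc k) x) (vscale n (1 / 2 ^ Suc k) x) = vscale n (1 / 2 ^ k) x"
  by (auto simp: vscale_def vadd_def fun_eq_iff)

lemma vscale_1: "x \<in> Rn n \<Longrightarrow> vscale n 1 x = x"
  by (auto simp: vscale_def Rn_eq PiE_iff extensional_def)

lemma measurable_vadd [measurable (raw)]:
  assumes "f \<in> N \<rightarrow>\<^sub>M borel_Rn n" "g \<in> N \<rightarrow>\<^sub>M borel_Rn n"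
  shows "(\<lambda>x. vadd n (f x) (g x)) \<in> N \<rightarrow>\<^sub>M borel_Rn n"
  using assms unfolding vadd_def borel_Rn_def by measurable

lemma measurable_vscale [measurable (raw)]:
  assumes "f \<in> N \<rightarrow>\<^sub>M borel_Rn n"
  shows "(\<lambda>x. vscale n c (f x)) \<in> N \<rightarrow>\<^sub>M borel_Rn n"
  using assms unfolding vscale_def borel_Rn_def by measurable

lemma sets_cube [measurable]: "cube n r \<in> sets (borel_Rn n)"
  unfolding cube_def borel_Rn_def by measurable

lemma sets_std_gaussian [measurable_cong, simp]: "sets (std_gaussian n) = sets (borel_Rn n)"
  unfolding std_gaussian_def borel_Rn_def by (intro sets_PiM_cong) auto

lemma space_std_gaussian [simp]: "space (std_gaussian n) = Rn n"
  by (rule sets_eq_imp_space_eq) simp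

lemma prob_space_std_gaussian: "prob_space (std_gaussian n)"
  unfolding std_gaussian_def by (intro prob_space_PiM prob_space_normal_density) simp

text \<open>The one-dimensional errors are summed over the coordinates. The radius may depend on
  \<open>n\<close>: it influences only the scaling exponent of the tester, not its number of
  queries.\<close>

lemma small_shift_almost_invariant:
  assumes "0 < \<tau>"
  shows "\<exists>r>0. \<forall>p\<in>cube n r. almost_invariant (std_gaussian n) (vadd n p) \<tau>"
proof -
  obtain C where C: "C \<ge> 0" and
    inv: "\<And>t. almost_invariant (density lborel std_normal_density) (\<lambda>x. t + x) (C * \<bar>t\<bar> + t\<^sup>2 / 2)"
    using normal_shift_almost_invariant by blast
  \<comment> \<open>Each coordinate costs at most \<open>(C + 1) * r\<close>: the cap at 1 gives
    \<open>r\<^sup>2 \<le> r\<close>, so the quadratic term is absorbed by the summand 1. Using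
    \<open>n + 1\<close> keeps the denominator positive for \<open>n = 0\<close>.\<close>
  define r where "r = min 1 (\<tau> / ((C + 1) * (real n + 1)))"
  have r: "0 < r" "r \<le> 1" using assms C by (auto simp: r_def)
  have "r * ((C + 1) * (real n + 1)) \<le> \<tau>"
    using C by (subst pos_le_divide_eq[symmetric]) (auto simp: r_def)
  moreover have "real n * ((C + 1) * r) \<le> r * ((C + 1) * (real n + 1))"
    using C r by (simp add: algebra_simps)
  ultimately have nr: "real n * ((C + 1) * r) \<le> \<tau>" by linarith
  have "almost_invariant (std_gaussian n) (vadd n p) \<tau>" if p: "p \<in> cube n r" for p
  proof (rule almost_invariant_mono)
    show "almost_invariant (std_gaussian n) (vadd n p) (\<Sum>i<n. C * \<bar>p i\<bar> + (p i)\<^sup>2 / 2)"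
      unfolding std_gaussian_def vadd_def
      by (intro almost_invariant_PiM inv prob_space_normal_density) auto
    have "(\<Sum>i<n. C * \<bar>p i\<bar> + (p i)\<^sup>2 / 2) \<le> (\<Sum>i<n. (C + 1) * r)"
    proof (rule sum_mono)
      fix i assume "i \<in> {..<n}"
      then have pi: "\<bar>p i\<bar> \<le> r" using p by (auto simp: cube_def)
      have "(p i)\<^sup>2 \<le> r\<^sup>2" using pi abs_le_square_iff[of "p i" r] r by simp
      also have "r\<^sup>2 \<le> r" using r by (simp add: power2_eq_square mult_left_le)
      finally show "C * \<bar>p i\<bar> + (p i)\<^sup>2 / 2 \<le> (C + 1) * r"
        using mult_left_mono[OF pi C] r by (simp add: algebra_simps)
    qed
    with nr show "(\<Sum>i<n. C * \<bar>p i\<bar> + (p i)\<^sup>2 / 2) \<le> \<tau>" by simp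
  qed
  with r show ?thesis by blast
qed

text \<open>The union bound for complements; it yields a common point of several events of large
  probability.\<close>

lemma (in prob_space) prob_Int_ge:
  assumes "A \<in> events" "B \<in> events"
  shows "prob A + prob B - 1 \<le> prob (A \<inter> B)"
  using finite_measure_Union'[OF assms] finite_measure_Diff'[of B A] prob_le_1[of "A \<union> B"] assms
  by (simp add: Int_commute)

section \<open>The additive function behind an almost additive one\<close>

text \<open>The constants are tied together by \<open>2 * (31/32 - 1/32) - 1 = 7/8\<close>, the
  concentration obtained in \<open>mode\<close>.\<close>

locale almost_additive =
  fixes n :: nat and f :: "vec \<Rightarrow> real" and r :: real
  assumes meas_f [measurable]: "f \<in> borel_measurable (borel_Rn n)"
    and r_pos: "0 < r"
    and shift: "\<And>p. p \<in> cube n r \<Longrightarrow> almost_invariant (std_gaussian n) (vadd n p) (1 / 32)"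
    and sum_test: "31 / 32 \<le> measure (std_gaussian n \<Otimes>\<^sub>M std_gaussian n)
      {z \<in> Rn n \<times> Rn n. f (vadd n (fst z) (snd z)) = f (fst z) + f (snd z)}"
begin

abbreviation \<gamma> where "\<gamma> \<equiv> std_gaussian n"

sublocale G: prob_space \<gamma> by (rule prob_space_std_gaussian)
sublocale GG: pair_prob_space \<gamma> \<gamma> ..

section \<open>The dominant increment\<close>

text \<open>For \<open>p\<close> in the cube the next lemma provides such a value, unique since
  \<open>7/8 > 1/2\<close>; elsewhere the choice may be arbitrary.\<close>

definition mode :: "vec \<Rightarrow> real" where
  "mode p = (SOME v. 7 / 8 \<le> measure \<gamma> {y \<in> Rn n. f (vadd n p y) - f y = v})"

text \<open>Almost invariance lets the sum check be applied to \<open>(p + x, y)\<close> and to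
  \<open>(x, p + y)\<close>. Both evaluate \<open>f (p + x + y)\<close>, so when both hold, the
  increments of \<open>f\<close> by \<open>p\<close> at \<open>x\<close> and at \<open>y\<close>
  agree. Averaging then fixes one \<open>x\<close> whose increment is the common value.\<close>

lemma mode:
  assumes p: "p \<in> cube n r"
  shows "7 / 8 \<le> measure \<gamma> {y \<in> Rn n. f (vadd n p y) - f y = mode p}"
proof -
  let ?GG = "\<gamma> \<Otimes>\<^sub>M \<gamma>"
  have sp: "space ?GG = Rn n \<times> Rn n" by (simp add: space_pair_measure)
  have p' [measurable]: "p \<in> Rn n" using p by (simp add: cube_def)
  define C where "C = {z \<in> Rn n \<times> Rn n. f (vadd n (fst z) (snd z)) = f (fst z) + f (snd z)}"
  define C1 where "C1 = (\<lambda>(x, y). (vadd n p x, y)) -` C \<inter> space ?GG"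
  define C2 where "C2 = (\<lambda>(x, y). (x, vadd n p y)) -` C \<inter> space ?GG"
  have C[measurable]: "C \<in> sets ?GG" unfolding C_def sp[symmetric] by measurable
  have C1: "C1 \<in> sets ?GG" unfolding C1_def by measurable
  have C2: "C2 \<in> sets ?GG" unfolding C2_def by measurable
  have "measure ?GG C - 1/32 \<le> measure ?GG C1"
    using almost_invariant_fst[OF G.prob_space_axioms G.prob_space_axioms shift[OF p]] C
    by (auto simp: almost_invariant_def C1_def)
  moreover have "measure ?GG C - 1/32 \<le> measure ?GG C2"
    using almost_invariant_snd[OF G.prob_space_axioms G.prob_space_axioms shift[OF p]] C
    by (auto simp: almost_invariant_def C2_def)
  moreover have "measure ?GG C1 + measure ?GG C2 - 1 \<le> measure ?GG (C1 \<inter> C2)"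
    by (rule GG.prob_Int_ge[OF C1 C2])
  ultimately have "7 / 8 \<le> measure ?GG (C1 \<inter> C2)"
    using sum_test by (simp add: C_def)
  also have "C1 \<inter> C2 \<subseteq> {z \<in> space ?GG. f (vadd n p (snd z)) - f (snd z) = f (vadd n p (fst z)) - f (fst z)}"
    by (auto simp: C1_def C2_def C_def vadd_assoc vadd_left_commute)
  then have "measure ?GG (C1 \<inter> C2)
      \<le> measure ?GG {z \<in> space ?GG. f (vadd n p (snd z)) - f (snd z) = f (vadd n p (fst z)) - f (fst z)}"
    by (rule GG.finite_measure_mono) measurable
  finally have D: "7 / 8 \<le> measure ?GG {z \<in> space ?GG. f (vadd n p (snd z)) - f (snd z) = f (vadd n p (fst z)) - f (fst z)}"
    (is "_ \<le> measure _ ?D") .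
  have D': "?D \<in> sets ?GG" by measurable
  note i = prob_pair_measure[OF G.prob_space_axioms G.prob_space_axioms D']
  \<comment> \<open>If every section had probability below 7/8, so would the whole event.\<close>
  have "\<exists>x. x \<in> Rn n \<and> 7 / 8 \<le> measure \<gamma> (Pair x -` ?D)"
  proof (rule ccontr)
    assume "\<not> ?thesis"
    then have *: "measure \<gamma> (Pair x -` ?D) < 7 / 8" if "x \<in> space \<gamma>" for x
      using that unfolding space_std_gaussian not_ex de_Morgan_conj not_le by blast
    have "(\<integral>x. measure \<gamma> (Pair x -` ?D) \<partial>\<gamma>) < 7 / 8"
      by (rule G.expectation_less[OF i(1)]) (rule AE_I2, rule *)
    with i(2) D show False by linarith
  qed
  then obtain x where x: "x \<in> Rn n" "7 / 8 \<le> measure \<gamma> (Pair x -` ?D)" by blast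
  then have "Pair x -` ?D = {y \<in> Rn n. f (vadd n p y) - f y = f (vadd n p x) - f x}"
    by (auto simp: sp)
  with x(2) show ?thesis
    unfolding mode_def by (intro someI) auto
qed

text \<open>The increment by \<open>p + q\<close> at \<open>y\<close> is the increment by
  \<open>p\<close> at \<open>q + y\<close> plus that by \<open>q\<close> at \<open>y\<close>. One
  \<open>y\<close> at which all three are dominant suffices.\<close>

lemma mode_vadd:
  assumes p: "p \<in> cube n r" and q: "q \<in> cube n r" and pq: "vadd n p q \<in> cube n r"
  shows "mode (vadd n p q) = mode p + mode q"
proof -
  have pq_Rn: "p \<in> Rn n" "q \<in> Rn n" using p q by (auto simp: cube_def)
  let ?A = "\<lambda>p. {y \<in> Rn n. f (vadd n p y) - f y = mode p}"
  have A: "?A x \<in> sets \<gamma>" if [measurable]: "x \<in> Rn n" for x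
    by simp
  \<comment> \<open>The points \<open>y\<close> for which \<open>q + y\<close> is typical for
    \<open>p\<close>; shifting by \<open>q\<close> costs 1/32.\<close>
  let ?A1 = "vadd n q -` ?A p \<inter> Rn n"
  have A1: "?A1 \<in> sets \<gamma>" and "measure \<gamma> (?A p) - 1/32 \<le> measure \<gamma> ?A1"
    using almost_invariantD[OF shift[OF q] A[OF pq_Rn(1)]] unfolding space_std_gaussian by simp_all
  then have "7/8 - 1/32 \<le> measure \<gamma> ?A1" using mode[OF p] by simp
  then have "7/8 - 1/32 + 7/8 - 1 \<le> measure \<gamma> (?A1 \<inter> ?A q)"
    using G.prob_Int_ge[OF A1 A[OF pq_Rn(2)]] mode[OF q] by simp
  \<comment> \<open>The bound left after the three intersections is 19/32.\<close>
  then have "0 < measure \<gamma> (?A1 \<inter> ?A q \<inter> ?A (vadd n p q))"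
    using G.prob_Int_ge[of "?A1 \<inter> ?A q" "?A (vadd n p q)"] A1 A[OF pq_Rn(2)] A[of "vadd n p q"] mode[OF pq] by simp
  then have "?A1 \<inter> ?A q \<inter> ?A (vadd n p q) \<noteq> {}" by (metis less_irrefl measure_empty)
  then show ?thesis by (auto simp: vadd_assoc)
qed

section \<open>Dyadic extension to the whole space\<close>

text \<open>Stated with "eventually" so that finitely many points can share one exponent.\<close>

lemma eventually_in_cube:
  assumes "x \<in> Rn n"
  shows "\<forall>\<^sub>F k in sequentially. vscale n (1 / 2 ^ k) x \<in> cube n r"
proof -
  have "\<forall>\<^sub>F k in sequentially. \<bar>1 / 2 ^ k * x i\<bar> < r" for i
  proof -
    have "(\<lambda>k. \<bar>(1/2) ^ k * x i\<bar>) \<longlonglongrightarrow> \<bar>0 * x i\<bar>"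
      by (intro tendsto_intros LIMSEQ_power_zero) simp
    from order_tendstoD(2)[OF this, of r] show ?thesis using r_pos by (simp add: power_divide)
  qed
  then have "\<forall>\<^sub>F k in sequentially. \<forall>i\<in>{..<n}. \<bar>1 / 2 ^ k * x i\<bar> < r"
    by (simp add: eventually_ball_finite_distrib)
  then show ?thesis by eventually_elim (auto simp: cube_def vscale_apply intro: less_imp_le)
qed

text \<open>The least exponent is only a canonical choice; \<open>extension_eq\<close> shows that
  every admissible exponent gives the same value.\<close>

definition extension :: "vec \<Rightarrow> real" where
  "extension x = (let k = LEAST k. vscale n (1 / 2 ^ k) x \<in> cube n r
     in 2 ^ k * mode (vscale n (1 / 2 ^ k) x))"

text \<open>Inside the cube, \<open>mode\<close> doubles when its argument doubles, so raising the
  exponent by one leaves the product unchanged.\<close>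

lemma extension_eq:
  assumes k: "vscale n (1 / 2 ^ k) x \<in> cube n r"
  shows "extension x = 2 ^ k * mode (vscale n (1 / 2 ^ k) x)"
proof -
  define K where "K = (LEAST k. vscale n (1 / 2 ^ k) x \<in> cube n r)"
  have K: "vscale n (1 / 2 ^ K) x \<in> cube n r" unfolding K_def by (rule LeastI[of _ k], rule k)
  have "K \<le> k" unfolding K_def by (rule Least_le, rule k)
  \<comment> \<open>Membership in the cube is carried along because each induction step applies
    \<open>mode_vadd\<close> at the halved point.\<close>
  then have "vscale n (1 / 2 ^ k) x \<in> cube n r \<and>
    2 ^ K * mode (vscale n (1 / 2 ^ K) x) = 2 ^ k * mode (vscale n (1 / 2 ^ k) x)"
  proof (induction k rule: dec_induct)
    case (step k)
    let ?y = "vscale n (1 / 2 ^ Suc k) x"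
    have "\<bar>?y i\<bar> \<le> r" if "i < n" for i
    proof -
      have "\<bar>?y i\<bar> = \<bar>vscale n (1 / 2 ^ k) x i\<bar> / 2" using that by (simp add: vscale_apply abs_mult)
      also have "\<dots> \<le> r" using step.IH that by (force simp: cube_def)
      finally show ?thesis .
    qed
    then have y: "?y \<in> cube n r" by (auto simp: cube_def)
    have "mode (vscale n (1 / 2 ^ k) x) = 2 * mode ?y"
      using mode_vadd[OF y y] step.IH by (simp only: vadd_vscale_half)
    then show ?case using y step.IH by simp
  qed (use K in auto)
  then show ?thesis by (simp add: extension_def K_def Let_def)
qed

lemma additive_extension: "additive_fun n extension"
  unfolding additive_fun_def
proof (intro ballI)
  fix x y assume "x \<in> Rn n" "y \<in> Rn n"
  then have "\<forall>\<^sub>F k in sequentially. vscale n (1 / 2 ^ k) x \<in> cube n r \<and> vscale n (1 / 2 ^ k) y \<in> cube n r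
      \<and> vscale n (1 / 2 ^ k) (vadd n x y) \<in> cube n r"
    by (intro eventually_conj eventually_in_cube) auto
  then obtain k where k: "vscale n (1 / 2 ^ k) x \<in> cube n r" "vscale n (1 / 2 ^ k) y \<in> cube n r"
      "vscale n (1 / 2 ^ k) (vadd n x y) \<in> cube n r"
    by (auto simp: eventually_sequentially)
  show "extension (vadd n x y) = extension x + extension y"
    using k mode_vadd[OF k(1,2)] by (simp add: extension_eq[OF k(1)] extension_eq[OF k(2)] extension_eq[OF k(3)] vscale_vadd algebra_simps)
qed

text \<open>Links \<open>extension\<close> to the quantity that the second check of a round
  evaluates.\<close>

lemma scaled_difference_eq_extension:
  assumes "vscale n (1 / 2 ^ k) x \<in> cube n r"
  shows "7 / 8 \<le> measure \<gamma> {y \<in> Rn n. 2 ^ k * (f (vadd n (vscale n (1 / 2 ^ k) x) y) - f y) = extension x}"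
  using mode[OF assms] by (simp add: extension_eq[OF assms])

text \<open>\<open>extension x \<le> a\<close> holds iff eventually more than half of the \<open>y\<close> have scaled increment \<open>\<le> a\<close>;
  this removes the choice operator hidden in \<open>mode\<close>.\<close>

lemma measurable_extension [measurable]: "extension \<in> borel_measurable (borel_Rn n)"
  unfolding borel_measurable_iff_le
proof
  fix a
  define D where "D k = {z \<in> space (borel_Rn n \<Otimes>\<^sub>M \<gamma>). 
    2 ^ k * (f (vadd n (vscale n (1 / 2 ^ k) (fst z)) (snd z)) - f (snd z)) \<le> a}" for k
  have D [measurable]: "D k \<in> sets (borel_Rn n \<Otimes>\<^sub>M \<gamma>)" for k
    unfolding D_def by measurable
  have [measurable]: "(\<lambda>x. measure \<gamma> (Pair x -` D k)) \<in> borel_measurable (borel_Rn n)" for k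
    using G.measurable_emeasure_Pair[OF D, of k] by (simp add: measure_def)
  have "extension x \<le> a \<longleftrightarrow> (\<forall>\<^sub>F k in sequentially. 1 / 2 < measure \<gamma> (Pair x -` D k))" if x: "x \<in> Rn n" for x
  proof -
    have "\<forall>\<^sub>F k in sequentially. 1 / 2 < measure \<gamma> (Pair x -` D k) \<longleftrightarrow> extension x \<le> a"
      using eventually_in_cube[OF x]
    proof eventually_elim
      case (elim k)
      let ?h = "\<lambda>y. 2 ^ k * (f (vadd n (vscale n (1 / 2 ^ k) x) y) - f y)"
      have Dx: "Pair x -` D k = {y \<in> Rn n. ?h y \<le> a}" using x by (auto simp: D_def space_pair_measure)
      have E: "{y \<in> Rn n. ?h y = extension x} \<in> sets \<gamma>" (is "?E \<in> _") by simp
      have Dm: "Pair x -` D k \<in> sets \<gamma>" by (rule sets_Pair1[OF D])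
      note E8 = scaled_difference_eq_extension[OF elim]
      show ?case
      proof
        assume "extension x \<le> a"
        then have "?E \<subseteq> Pair x -` D k" by (auto simp: Dx)
        from G.finite_measure_mono[OF this Dm] E8 show "1 / 2 < measure \<gamma> (Pair x -` D k)" by simp
      next
        assume "1 / 2 < measure \<gamma> (Pair x -` D k)"
        \<comment> \<open>Since \<open>7/8 + 1/2 > 1\<close>, the two sets meet.\<close>
        with G.prob_Int_ge[OF E Dm] E8 have "0 < measure \<gamma> (?E \<inter> Pair x -` D k)" by simp
        then have "?E \<inter> Pair x -` D k \<noteq> {}" by (metis less_irrefl measure_empty)
        then show "extension x \<le> a" by (auto simp: Dx)
      qed
    qed
    from eventually_cong[OF this] show ?thesis by simp
  qed
  then have "{x \<in> Rn n. extension x \<le> a} = {x \<in> Rn n. \<forall>\<^sub>F k in sequentially. 1 / 2 < measure \<gamma> (Pair x -` D k)}"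
    by auto
  also have "\<dots> \<in> sets (borel_Rn n)" by measurable
  finally show "{x \<in> Rn n. extension x \<le> a} \<in> sets (borel_Rn n)" .
qed

text \<open>\<open>f\<close> differs from \<open>extension\<close> with probability above
  \<epsilon>, and discarding the points that scale to outside the cube costs at most \<epsilon>/2.
  For each remaining \<open>x\<close>, at least 7/8 of the \<open>y\<close> produce
  \<open>extension x\<close>, which is not \<open>f x\<close>. This gives
  \<open>7/8 * \<epsilon>/2\<close>.\<close>

lemma scaling_test_fails:
  assumes far: "far_from_additive n \<epsilon> f"
    and k: "1 - \<epsilon> / 2 \<le> measure \<gamma> {x \<in> Rn n. vscale n (1 / 2 ^ k) x \<in> cube n r}"
  shows "7 / 16 * \<epsilon> \<le> measure (\<gamma> \<Otimes>\<^sub>M \<gamma>) {z \<in> Rn n \<times> Rn n.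
    f (fst z) \<noteq> 2 ^ k * (f (vadd n (vscale n (1 / 2 ^ k) (fst z)) (snd z)) - f (snd z))}"
    (is "_ \<le> measure _ ?C")
proof -
  let ?B = "{x \<in> Rn n. vscale n (1 / 2 ^ k) x \<in> cube n r}" and ?F = "{x \<in> Rn n. f x \<noteq> extension x}"
  let ?h = "\<lambda>x y. 2 ^ k * (f (vadd n (vscale n (1 / 2 ^ k) x) y) - f y)"
  have B [measurable]: "?B \<in> sets \<gamma>" by measurable
  have F [measurable]: "?F \<in> sets \<gamma>"
    unfolding sets_std_gaussian by (rule borel_measurable_neq[OF meas_f measurable_extension])
  have BF [measurable]: "?F \<inter> ?B \<in> sets \<gamma>" by measurable
  have "\<epsilon> < measure \<gamma> ?F"
    using far additive_extension measurable_extension by (auto simp: far_from_additive_def)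
  then have "\<epsilon> / 2 \<le> measure \<gamma> (?F \<inter> ?B)"
    using G.prob_Int_ge[OF F B] k by linarith
  then have "7 / 16 * \<epsilon> \<le> (\<integral>x. 7 / 8 * indicator (?F \<inter> ?B) x \<partial>\<gamma>)"
    using Int_absorb2[of "?F \<inter> ?B" "Rn n"] by (simp add: subset_iff)
  have sp: "Rn n \<times> Rn n = space (\<gamma> \<Otimes>\<^sub>M \<gamma>)" by (simp add: space_pair_measure)
  have C: "?C \<in> sets (\<gamma> \<Otimes>\<^sub>M \<gamma>)" unfolding sp by measurable
  note i = prob_pair_measure[OF G.prob_space_axioms G.prob_space_axioms C]
  have "(\<integral>x. 7 / 8 * indicator (?F \<inter> ?B) x \<partial>\<gamma>) \<le> (\<integral>x. measure \<gamma> (Pair x -` ?C) \<partial>\<gamma>)"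
  proof (rule integral_mono)
    show "integrable \<gamma> (\<lambda>x. 7 / 8 * indicator (?F \<inter> ?B) x :: real)"
      using BF by (intro integrable_mult_right integrable_real_indicator) (auto simp: G.emeasure_eq_measure)
    fix x assume x: "x \<in> space \<gamma>"
    have "7 / 8 \<le> measure \<gamma> (Pair x -` ?C)" if "x \<in> ?F \<inter> ?B"
    proof -
      have "{y \<in> Rn n. ?h x y = extension x} \<subseteq> Pair x -` ?C" using that by auto
      from G.finite_measure_mono[OF this sets_Pair1[OF C]] show ?thesis
        using scaled_difference_eq_extension[of k x] that by auto
    qed
    then show "7 / 8 * indicator (?F \<inter> ?B) x \<le> measure \<gamma> (Pair x -` ?C)"
      by (cases "x \<in> ?F \<inter> ?B") auto
  qed (rule i(1))
  with i(2) \<open>7 / 16 * \<epsilon> \<le> _\<close> show ?thesis by linarith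
qed

end

section \<open>The tester\<close>

definition round_passes :: "nat \<Rightarrow> nat \<Rightarrow> (vec \<Rightarrow> real) \<Rightarrow> vec \<Rightarrow> vec \<Rightarrow> bool" where
  "round_passes n k f x y \<longleftrightarrow> f (vadd n x y) = f x + f y \<and>
     f x = 2 ^ k * (f (vadd n (vscale n (1 / 2 ^ k) x) y) - f y)"

text \<open>Every round draws a fresh pair, which makes the rounds independent; the answers
  \<open>a\<close>, \<open>b\<close>, \<open>c\<close>, \<open>d\<close> are the four values
  occurring in \<open>round_passes\<close>.\<close>

primrec tester :: "nat \<Rightarrow> nat \<Rightarrow> nat \<Rightarrow> algorithm" where
  "tester n k 0 = Accept"
| "tester n k (Suc m) = Sample (\<lambda>x. Sample (\<lambda>y.
     Query x (\<lambda>a. Query y (\<lambda>b. Query (vadd n x y) (\<lambda>c.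
     Query (vadd n (vscale n (1 / 2 ^ k) x) y) (\<lambda>d.
       if c = a + b \<and> a = 2 ^ k * (d - b) then tester n k m else Reject))))))"

lemma well_formed_tester: "well_formed n (tester n k m)"
  by (induction m) auto

lemma num_queries_tester: "num_queries (tester n k m) f \<omega> \<le> 4 * m"
proof (induction m arbitrary: \<omega>)
  case (Suc m)
  then show ?case using Suc.IH[of "stl (stl \<omega>)"] by simp
qed simp

lemma accepts_tester_Suc:
  "accepts (tester n k (Suc m)) f \<omega> \<longleftrightarrow>
     round_passes n k f (shd \<omega>) (shd (stl \<omega>)) \<and> accepts (tester n k m) f (stl (stl \<omega>))"
  by (auto simp: round_passes_def)

section \<open>Additive functions are always accepted\<close>

lemma additive_vscale:
  assumes f: "additive_fun n f" and x: "x \<in> Rn n"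
  shows "f x = 2 ^ k * f (vscale n (1 / 2 ^ k) x)"
proof (induction k)
  case 0
  then show ?case using x by (simp add: vscale_1)
next
  case (Suc k)
  let ?y = "vscale n (1 / 2 ^ Suc k) x"
  have "f (vscale n (1 / 2 ^ k) x) = 2 * f ?y"
    using f vadd_vscale_half[of n k x] unfolding additive_fun_def by (metis vscale_in_Rn mult_2)
  with Suc show ?case by simp
qed

lemma additive_round_passes:
  assumes "additive_fun n f" "x \<in> Rn n" "y \<in> Rn n"
  shows "round_passes n k f x y"
  using assms additive_vscale[OF assms(1,2), of k] by (simp add: round_passes_def additive_fun_def)

lemma space_samples: "space (samples n) = streams (Rn n)"
  by (simp add: samples_def space_stream_space)

text \<open>Acceptance on every stream, not just on almost every one, gives the one-sided
  error.\<close>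

lemma accepts_tester_additive:
  assumes "additive_fun n f" "\<omega> \<in> streams (Rn n)"
  shows "accepts (tester n k m) f \<omega>"
  using assms(2)
proof (induction m arbitrary: \<omega>)
  case (Suc m)
  have "\<omega> = shd \<omega> ## shd (stl \<omega>) ## stl (stl \<omega>)" by simp
  then have *: "shd \<omega> \<in> Rn n" "shd (stl \<omega>) \<in> Rn n" "stl (stl \<omega>) \<in> streams (Rn n)"
    using Suc.prems by (metis streams_Stream)+
  then show ?case
    using Suc.IH additive_round_passes[OF assms(1)] unfolding accepts_tester_Suc by blast
qed simp

section \<open>Acceptance probability of independent rounds\<close>

lemma measurable_round_passes:
  assumes [measurable]: "f \<in> borel_measurable (borel_Rn n)"
    and [measurable]: "g \<in> N \<rightarrow>\<^sub>M borel_Rn n" "h \<in> N \<rightarrow>\<^sub>M borel_Rn n"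
  shows "Measurable.pred N (\<lambda>z. round_passes n k f (g z) (h z))"
  unfolding round_passes_def by measurable

lemma measurable_accepts_tester:
  assumes f: "f \<in> borel_measurable (borel_Rn n)"
  shows "Measurable.pred (samples n) (\<lambda>\<omega>. accepts (tester n k m) f \<omega>)"
proof (induction m)
  case (Suc m)
  have 1: "shd \<in> samples n \<rightarrow>\<^sub>M borel_Rn n" and 2: "stl \<in> samples n \<rightarrow>\<^sub>M samples n"
    using measurable_shd[of "std_gaussian n"] measurable_stl[of "std_gaussian n"]
    by (simp_all add: samples_def cong: measurable_cong_sets)
  note [measurable] = measurable_round_passes[OF f 1 measurable_compose[OF 2 1]]
    measurable_compose[OF measurable_compose[OF 2 2] Suc.IH]
  show ?case unfolding accepts_tester_Suc by measurable
qed simp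

text \<open>Each round uses the first two samples, and the rest of the stream has the same law and
  is independent of them. Hence one more round multiplies the probability by that of passing a
  single round.\<close>

lemma prob_accept_tester:
  assumes f: "f \<in> borel_measurable (borel_Rn n)"
  shows "measure (samples n) (accept_event n (tester n k m) f) =
    measure (std_gaussian n \<Otimes>\<^sub>M std_gaussian n) {z \<in> Rn n \<times> Rn n. round_passes n k f (fst z) (snd z)} ^ m"
proof -
  interpret G: prob_space "std_gaussian n" by (rule prob_space_std_gaussian)
  interpret S: prob_space "samples n" unfolding samples_def by (rule G.prob_space_stream_space)
  interpret GG: pair_prob_space "std_gaussian n" "std_gaussian n" ..
  let ?GG = "std_gaussian n \<Otimes>\<^sub>M std_gaussian n"
  let ?R = "{z \<in> Rn n \<times> Rn n. round_passes n k f (fst z) (snd z)}"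
  let ?a = "\<lambda>m. accept_event n (tester n k m) f"
  have "?R = {z \<in> space ?GG. round_passes n k f (fst z) (snd z)}" by (auto simp: space_pair_measure)
  also have "\<dots> \<in> sets ?GG"
    by (intro predE measurable_round_passes[OF f]) measurable
  finally have R: "?R \<in> sets ?GG" .
  have ind: "(indicator ?R :: _ \<Rightarrow> ennreal) \<in> borel_measurable ?GG"
    using R by (rule borel_measurable_indicator)
  have sets: "?a m \<in> sets (samples n)" for m
    using measurable_accepts_tester[OF f, of k m] by (simp add: accept_event_def)
  have "emeasure (samples n) (?a (Suc m)) = emeasure ?GG ?R * emeasure (samples n) (?a m)" for m
  proof -
    have meas: "{\<omega> \<in> space (samples n). x ## \<omega> \<in> ?a (Suc m)} \<in> sets (samples n)" if "x \<in> Rn n" for x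
    proof -
      have "(##) x \<in> samples n \<rightarrow>\<^sub>M samples n" using that unfolding samples_def
        by (intro measurable_Stream measurable_const measurable_ident_sets) auto
      from measurable_sets[OF this sets[of "Suc m"]] show ?thesis by (simp add: vimage_def Int_def conj_commute)
    qed
    have "emeasure (samples n) (?a (Suc m))
      = (\<integral>\<^sup>+x. emeasure (samples n) {\<omega> \<in> space (samples n). x ## \<omega> \<in> ?a (Suc m)} \<partial>std_gaussian n)"
      using sets[of "Suc m"] unfolding samples_def by (rule G.emeasure_stream_space)
    \<comment> \<open>The second sample is split off in the same way as the first.\<close>
    also have "\<dots> = (\<integral>\<^sup>+x. (\<integral>\<^sup>+y. emeasure (samples n) {\<omega> \<in> space (samples n).
        y ## \<omega> \<in> {\<omega> \<in> space (samples n). x ## \<omega> \<in> ?a (Suc m)}} \<partial>std_gaussian n) \<partial>std_gaussian n)"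
      by (rule nn_integral_cong) (use meas in \<open>simp only: samples_def space_std_gaussian G.emeasure_stream_space\<close>)
    also have "\<dots> = (\<integral>\<^sup>+x. (\<integral>\<^sup>+y. indicator ?R (x, y) * emeasure (samples n) (?a m) \<partial>std_gaussian n) \<partial>std_gaussian n)"
    proof (intro nn_integral_cong)
      fix x y assume xy: "x \<in> space (std_gaussian n)" "y \<in> space (std_gaussian n)"
      \<comment> \<open>With \<open>x\<close> and \<open>y\<close> fixed, the event is that of the
        remaining \<open>m\<close> rounds, or empty if this round fails.\<close>
      then have "{\<omega> \<in> space (samples n). y ## \<omega> \<in> {\<omega> \<in> space (samples n). x ## \<omega> \<in> ?a (Suc m)}}
        = (if round_passes n k f x y then ?a m else {})"
        unfolding accept_event_def accepts_tester_Suc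
        by (auto simp: space_samples streams_Stream)
      then show "emeasure (samples n) {\<omega> \<in> space (samples n). y ## \<omega> \<in> {\<omega> \<in> space (samples n). x ## \<omega> \<in> ?a (Suc m)}}
        = indicator ?R (x, y) * emeasure (samples n) (?a m)"
        using xy by (simp add: indicator_def)
    qed
    also have "\<dots> = (\<integral>\<^sup>+x. (\<integral>\<^sup>+y. indicator ?R (x, y) \<partial>std_gaussian n) * emeasure (samples n) (?a m) \<partial>std_gaussian n)"
      by (intro nn_integral_cong nn_integral_multc measurable_Pair2[OF ind])
    also have "\<dots> = (\<integral>\<^sup>+x. (\<integral>\<^sup>+y. indicator ?R (x, y) \<partial>std_gaussian n) \<partial>std_gaussian n) * emeasure (samples n) (?a m)"
      by (intro nn_integral_multc G.borel_measurable_nn_integral_fst[OF ind])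
    also have "(\<integral>\<^sup>+x. (\<integral>\<^sup>+y. indicator ?R (x, y) \<partial>std_gaussian n) \<partial>std_gaussian n) = emeasure ?GG ?R"
      by (rule G.emeasure_pair_measure[symmetric, OF R])
    finally show ?thesis .
  qed
  then have step: "measure (samples n) (?a (Suc m)) = measure ?GG ?R * measure (samples n) (?a m)" for m
    by (simp add: measure_def enn2real_mult)
  show ?thesis
  proof (induction m)
    case 0
    then show ?case by (simp add: accept_event_def S.prob_space)
  next
    case (Suc m)
    then show ?case by (simp add: step del: tester.simps)
  qed
qed

section \<open>Rejection of far functions\<close>

text \<open>The dilated cubes increase to the whole space, so continuity from below applies.\<close>

lemma exists_scale_in_cube:
  assumes r: "0 < r" and \<epsilon>: "0 < \<epsilon>"
  shows "\<exists>k. 1 - \<epsilon> \<le> measure (std_gaussian n) {x \<in> Rn n. vscale n (1 / 2 ^ k) x \<in> cube n r}"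
proof -
  interpret G: prob_space "std_gaussian n" by (rule prob_space_std_gaussian)
  let ?B = "\<lambda>k. {x \<in> Rn n. vscale n (1 / 2 ^ k) x \<in> cube n r}"
  have B: "?B k = {x \<in> Rn n. \<forall>i<n. \<bar>x i\<bar> \<le> r * 2 ^ k}" for k
    by (auto simp: cube_def vscale_apply abs_mult pos_divide_le_eq)
  have "?B k \<in> sets (std_gaussian n)" for k
    by measurable
  moreover have "incseq ?B"
    unfolding B
  proof (intro monoI)
    fix j k :: nat assume "j \<le> k"
    then have "r * 2 ^ j \<le> r * 2 ^ k" using r by simp
    then show "{x \<in> Rn n. \<forall>i<n. \<bar>x i\<bar> \<le> r * 2 ^ j} \<le> {x \<in> Rn n. \<forall>i<n. \<bar>x i\<bar> \<le> r * 2 ^ k}"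
      by (auto intro: order_trans)
  qed
  ultimately have lim: "(\<lambda>k. measure (std_gaussian n) (?B k)) \<longlonglongrightarrow> measure (std_gaussian n) (\<Union>k. ?B k)"
    by (intro G.finite_Lim_measure_incseq) auto
  have "(\<Union>k. ?B k) = Rn n"
  proof (intro equalityI subsetI)
    fix x assume x: "x \<in> Rn n"
    \<comment> \<open>Inserting 0 keeps the set nonempty when \<open>n = 0\<close>.\<close>
    define b where "b = Max (insert 0 ((\<lambda>i. \<bar>x i\<bar>) ` {..<n}))"
    obtain k where k: "b / r < 2 ^ k"
      using real_arch_pow[of 2] by auto
    have "\<bar>x i\<bar> \<le> r * 2 ^ k" if "i < n" for i
    proof -
      have "\<bar>x i\<bar> \<le> b" unfolding b_def using that by (intro Max_ge) auto
      also have "\<dots> \<le> r * 2 ^ k" using k r by (simp add: field_simps)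
      finally show ?thesis .
    qed
    with x show "x \<in> (\<Union>k. ?B k)" by (auto simp: B)
  qed auto
  then have "measure (std_gaussian n) (\<Union>k. ?B k) = 1" using G.prob_space by simp
  with lim have "\<forall>\<^sub>F k in sequentially. 1 - \<epsilon> < measure (std_gaussian n) (?B k)"
    using \<epsilon> by (intro order_tendstoD(1)) auto
  then show ?thesis by (auto simp: eventually_sequentially intro: less_imp_le)
qed

text \<open>Either the sum check alone fails with probability above 1/32, or
  \<open>almost_additive\<close> applies and the scaling check fails with probability at least
  \<open>7/16 * \<epsilon>\<close>.\<close>

lemma far_round_fails:
  assumes f: "f \<in> borel_measurable (borel_Rn n)" and r: "0 < r"
    and shift: "\<And>p. p \<in> cube n r \<Longrightarrow> almost_invariant (std_gaussian n) (vadd n p) (1 / 32)"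
    and k: "1 - \<epsilon> / 2 \<le> measure (std_gaussian n) {x \<in> Rn n. vscale n (1 / 2 ^ k) x \<in> cube n r}"
    and far: "far_from_additive n \<epsilon> f" and \<epsilon>: "0 < \<epsilon>"
  shows "measure (std_gaussian n \<Otimes>\<^sub>M std_gaussian n) {z \<in> Rn n \<times> Rn n. round_passes n k f (fst z) (snd z)}
    \<le> 1 - \<epsilon> / 32"
proof -
  interpret G: prob_space "std_gaussian n" by (rule prob_space_std_gaussian)
  interpret GG: pair_prob_space "std_gaussian n" "std_gaussian n" ..
  let ?GG = "std_gaussian n \<Otimes>\<^sub>M std_gaussian n"
  let ?A = "{z \<in> Rn n \<times> Rn n. f (vadd n (fst z) (snd z)) = f (fst z) + f (snd z)}"
  let ?B = "{z \<in> Rn n \<times> Rn n. f (fst z) \<noteq> 2 ^ k * (f (vadd n (vscale n (1 / 2 ^ k) (fst z)) (snd z)) - f (snd z))}"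
  let ?R = "{z \<in> Rn n \<times> Rn n. round_passes n k f (fst z) (snd z)}"
  note [measurable] = f
  have sp: "Rn n \<times> Rn n = space ?GG" by (simp add: space_pair_measure)
  have A: "?A \<in> sets ?GG" and B: "?B \<in> sets ?GG" unfolding sp by measurable
  have RA: "?R \<subseteq> ?A" and RB: "?R \<subseteq> space ?GG - ?B" by (auto simp: round_passes_def sp)
  \<comment> \<open>Being far from the zero function forces \<open>\<epsilon> \<le> 1\<close>, so
    that 1/32 is at least \<epsilon>/32 in the second case.\<close>
  have "additive_fun n (\<lambda>_. 0)" by (simp add: additive_fun_def)
  then have "\<epsilon> < measure (std_gaussian n) {x \<in> Rn n. f x \<noteq> 0}"
    using far by (auto simp: far_from_additive_def)
  then have "\<epsilon> \<le> 1" using G.prob_le_1[of "{x \<in> Rn n. f x \<noteq> 0}"] by linarith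
  show ?thesis
  proof (cases "31 / 32 \<le> measure ?GG ?A")
    case True
    interpret almost_additive n f r
      using f r shift True by unfold_locales
    have "measure ?GG ?R \<le> 1 - measure ?GG ?B"
      using GG.finite_measure_mono[OF RB sets.compl_sets[OF B]] GG.prob_compl[OF B] by linarith
    then show ?thesis using scaling_test_fails[OF far k] \<epsilon> by simp
  next
    case False
    then show ?thesis using GG.finite_measure_mono[OF RA A] \<open>\<epsilon> \<le> 1\<close> by simp
  qed
qed

text \<open>With \<open>m \<ge> 64 / \<epsilon>\<close> rounds a far function is accepted with
  probability at most \<open>(1 - \<epsilon>/32)^m \<le> exp (-2) \<le> 1/3\<close>; the last bound
  is \<open>exp 2 \<ge> 1 + 2\<close>.\<close>

lemma tester_correct:
  assumes r: "0 < r" and \<epsilon>: "0 < \<epsilon>"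
    and shift: "\<And>p. p \<in> cube n r \<Longrightarrow> almost_invariant (std_gaussian n) (vadd n p) (1 / 32)"
    and k: "1 - \<epsilon> / 2 \<le> measure (std_gaussian n) {x \<in> Rn n. vscale n (1 / 2 ^ k) x \<in> cube n r}"
    and m: "64 / \<epsilon> \<le> real m"
  shows "additivity_tester n \<epsilon> (tester n k m)" and "one_sided n (tester n k m)"
proof -
  interpret G: prob_space "std_gaussian n" by (rule prob_space_std_gaussian)
  interpret GG: pair_prob_space "std_gaussian n" "std_gaussian n" ..
  interpret S: prob_space "samples n" unfolding samples_def by (rule G.prob_space_stream_space)
  show one: "one_sided n (tester n k m)"
    unfolding one_sided_def
  proof (intro ballI impI)
    fix f :: "vec \<Rightarrow> real" assume "additive_fun n f"
    then have "accept_event n (tester n k m) f = space (samples n)"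
      using accepts_tester_additive by (auto simp: accept_event_def space_samples)
    then show "measure (samples n) (accept_event n (tester n k m) f) = 1"
      by (simp add: S.prob_space)
  qed
  show "additivity_tester n \<epsilon> (tester n k m)"
    unfolding additivity_tester_def
  proof (intro conjI ballI impI well_formed_tester)
    fix f :: "vec \<Rightarrow> real" assume f: "f \<in> borel_measurable (borel_Rn n)"
    show E: "accept_event n (tester n k m) f \<in> sets (samples n)"
      using measurable_accepts_tester[OF f, of k m] by (simp add: accept_event_def)
    show "2 / 3 \<le> measure (samples n) (accept_event n (tester n k m) f)" if "additive_fun n f"
      using one f that by (simp add: one_sided_def)
    assume far: "far_from_additive n \<epsilon> f"
    let ?p = "measure (std_gaussian n \<Otimes>\<^sub>M std_gaussian n) {z \<in> Rn n \<times> Rn n. round_passes n k f (fst z) (snd z)}"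
    have "?p \<le> 1 - \<epsilon> / 32" by (rule far_round_fails[OF f r shift k far \<epsilon>])
    also have "\<dots> \<le> exp (- (\<epsilon> / 32))" using exp_ge_add_one_self[of "- (\<epsilon> / 32)"] by simp
    finally have "?p ^ m \<le> exp (- (\<epsilon> / 32)) ^ m" by (intro power_mono) auto
    also have "\<dots> = exp (- (real m * (\<epsilon> / 32)))" by (simp add: exp_of_nat_mult[symmetric])
    also have "\<dots> \<le> exp (- 2)" using m \<epsilon> by (simp add: field_simps)
    also have "\<dots> \<le> 1 / 3"
      using exp_ge_add_one_self[of "2::real"] by (simp add: exp_minus field_simps)
    finally have "measure (samples n) (accept_event n (tester n k m) f) \<le> 1 / 3"
      by (simp add: prob_accept_tester[OF f])
    moreover have "reject_event n (tester n k m) f = space (samples n) - accept_event n (tester n k m) f"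
      by (auto simp: reject_event_def accept_event_def)
    ultimately show "2 / 3 \<le> measure (samples n) (reject_event n (tester n k m) f)"
      using S.prob_compl[OF E] by simp
  qed
qed

theorem theorem3p1:
  "\<exists>q :: real \<Rightarrow> nat.
     (\<lambda>\<epsilon>. real (q \<epsilon>)) \<in> O[at_right 0](\<lambda>\<epsilon>. 1 / \<epsilon> * ln (1 / \<epsilon>)) \<and>
     (\<forall>n\<ge>1. \<exists>T :: real \<Rightarrow> algorithm. \<forall>\<epsilon>>0.
        additivity_tester n \<epsilon> (T \<epsilon>) \<and> one_sided n (T \<epsilon>) \<and> makes_at_most n (T \<epsilon>) (q \<epsilon>))"
proof -
  define m where "m \<epsilon> = nat \<lceil>64 / \<epsilon>\<rceil>" for \<epsilon> :: real
  let ?q = "\<lambda>\<epsilon>. 4 * m \<epsilon>"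
  show ?thesis
  proof (intro exI[of _ ?q] conjI allI impI)
    show "(\<lambda>\<epsilon>. real (?q \<epsilon>)) \<in> O[at_right 0](\<lambda>\<epsilon>. 1 / \<epsilon> * ln (1 / \<epsilon>))"
    \<comment> \<open>Four queries per round, and at most
      \<open>64/\<epsilon> + 1 \<le> 65/\<epsilon>\<close> rounds for
      \<open>\<epsilon> \<le> 1\<close>.\<close>
    proof (rule bigoI[where c = 260])
      \<comment> \<open>Below \<open>exp (-1)\<close> the factor \<open>ln (1 / \<epsilon>)\<close>
        is at least 1, so a bound of order \<open>1/\<epsilon>\<close> is enough.\<close>
      have "\<forall>\<^sub>F \<epsilon> in at_right 0. 0 < \<epsilon> \<and> \<epsilon> < exp (- 1 :: real)"
        by (auto simp: eventually_at_right_field intro!: exI[of _ "exp (-1)"])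
      then show "\<forall>\<^sub>F \<epsilon> in at_right 0. norm (real (?q \<epsilon>)) \<le> 260 * norm (1 / \<epsilon> * ln (1 / \<epsilon>))"
      proof eventually_elim
        case (elim \<epsilon>)
        then have "ln \<epsilon> \<le> - 1" by (metis exp_gt_zero less_imp_le ln_exp ln_le_cancel_iff)
        then have ln: "1 \<le> ln (1 / \<epsilon>)" using elim by (simp add: ln_div)
        have "\<epsilon> \<le> 1" using elim exp_le_one_iff[of "- 1 :: real"] by linarith
        then have "1 \<le> 1 / \<epsilon>" using elim by simp
        have "real (m \<epsilon>) \<le> 64 / \<epsilon> + 1" unfolding m_def using elim by (simp add: ceiling_correct)
        also have "\<dots> \<le> 65 * (1 / \<epsilon>)" using \<open>1 \<le> 1 / \<epsilon>\<close> by simp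
        also have "\<dots> \<le> 65 * (1 / \<epsilon> * ln (1 / \<epsilon>))"
          using mult_left_mono[OF ln, of "1 / \<epsilon>"] elim by simp
        finally show ?case using ln elim by (simp add: abs_of_nonneg)
      qed
    qed
    fix n :: nat
    obtain r where r: "0 < r"
      "\<And>p. p \<in> cube n r \<Longrightarrow> almost_invariant (std_gaussian n) (vadd n p) (1 / 32)"
      using small_shift_almost_invariant[of "1 / 32" n] by auto
    have "\<exists>k. 1 - \<epsilon> / 2 \<le> measure (std_gaussian n) {x \<in> Rn n. vscale n (1 / 2 ^ k) x \<in> cube n r}" if "0 < \<epsilon>" for \<epsilon>
      using exists_scale_in_cube[OF r(1), of "\<epsilon> / 2"] that by simp
    \<comment> \<open>The exponent is chosen for all \<epsilon> at once, as \<open>T\<close> is a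
      function of \<epsilon>. It may depend on \<open>n\<close>, while the number of rounds does
      not.\<close>
    then obtain k where k: "0 < \<epsilon> \<Longrightarrow> 1 - \<epsilon> / 2 \<le> measure (std_gaussian n)
        {x \<in> Rn n. vscale n (1 / 2 ^ k \<epsilon>) x \<in> cube n r}" for \<epsilon>
      by metis
    show "\<exists>T. \<forall>\<epsilon>>0. additivity_tester n \<epsilon> (T \<epsilon>) \<and> one_sided n (T \<epsilon>) \<and> makes_at_most n (T \<epsilon>) (?q \<epsilon>)"
    proof (intro exI[of _ "\<lambda>\<epsilon>. tester n (k \<epsilon>) (m \<epsilon>)"] allI impI conjI)
      fix \<epsilon> :: real assume \<epsilon>: "0 < \<epsilon>"
      have "64 / \<epsilon> \<le> real (m \<epsilon>)" unfolding m_def by (rule real_nat_ceiling_ge)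
      note * = tester_correct[OF r(1) \<epsilon> r(2) k[OF \<epsilon>] this]
      show "additivity_tester n \<epsilon> (tester n (k \<epsilon>) (m \<epsilon>))" "one_sided n (tester n (k \<epsilon>) (m \<epsilon>))"
        using * by auto
      show "makes_at_most n (tester n (k \<epsilon>) (m \<epsilon>)) (?q \<epsilon>)"
        by (simp add: makes_at_most_def num_queries_tester)
    qed
  qed
qed

end
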